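(* Let $0\le\phi\le\pi/2$, $\omega_1:=\omega(\theta,\phi)$, $\omega_2:=\omega(\theta,\phi,\psi)$, where $\psi=\phi(1-\omega_1/\pi)$. Then for any $\theta$-code $C\subset\mathrm{Cap}(n,\phi)$ we have $$|C([\psi,\phi])|\le A(n-1,\min(\omega_1,\omega_2))$$ and $$|C([\psi,\phi])|+2\,|C(\psi)|\le A(n,\omega_1).$$
   Context: $S^{n-1}$ is the unit sphere in $\mathbb R^n$, $e_n=(0,\dots,0,1)$, and $\operatorname{dist}$ is angular distance on the sphere. For $0\le\alpha\le\beta\le\pi/2$, $Z(n,[\alpha,\beta])=\{x\in S^{n-1}:\cos\beta\le\langle x,e_n\rangle\le\cos\alpha\}$ is a (closed) spherical strip, and $\mathrm{Cap}(n,\beta)=Z(n,[0,\beta])$ is the spherical cap of angular radius $\beta$ about $e_n$. A finite set $C$ of points is a $\theta$-code if $\operatorname{dist}(x,y)\ge\theta$ for any two distinct $x,y\in C$. $A(n,\theta)$ is the maximum size of a $\theta$-code on the whole sphere $S^{n-1}$. For a code $C$, $C([\alpha,\beta])=C\cap Z(n,[\alpha,\beta])$ and $C(\alpha)=C\cap\mathrm{Cap}(n,\alpha)$. The angle $\omega(\theta,\alpha,\beta)$ is defined by $$\cos\omega(\theta,\alpha,\beta)=\frac{\cos\theta-\cos\alpha\cos\beta}{\sin\alpha\sin\beta},$$ and $\omega(\theta,\alpha):=\omega(\theta,\alpha,\alpha)$.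
   Formalization: In the second inequality, points of C at angle exactly ψ are counted only in C(ψ), not also in C([ψ,φ]) (as printed it fails, e.g. φ=θ=π/2); ω₁ is assumed to exist, and the first inequality is claimed only when ω₂ exists; 0<θ≤π and n≥2. *)

theory Defs
  imports Complex_Main "Jordan_Normal_Form.Matrix"
begin

definition usphere :: "nat \<Rightarrow> real vec set" where
  "usphere n = {x \<in> carrier_vec n. x \<bullet> x = 1}"

definition adist :: "real vec \<Rightarrow> real vec \<Rightarrow> real" where
  "adist x y = arccos (x \<bullet> y)"

(* Coordinates of a vector are numbered 0, ..., n - 1, so unit_vec n (n - 1) is (0, ..., 0, 1). *)
definition strip :: "nat \<Rightarrow> real \<Rightarrow> real \<Rightarrow> real vec set" where
  "strip n \<alpha> \<beta> =
     {x \<in> usphere n. cos \<beta> \<le> x \<bullet> unit_vec n (n - 1) \<and> x \<bullet> unit_vec n (n - 1) \<le> cos \<alpha>}"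

definition cap :: "nat \<Rightarrow> real \<Rightarrow> real vec set" where
  "cap n \<beta> = strip n 0 \<beta>"

definition spherical_code :: "nat \<Rightarrow> real \<Rightarrow> real vec set \<Rightarrow> bool" where
  "spherical_code n \<theta> C \<longleftrightarrow>
     finite C \<and> C \<subseteq> usphere n \<and> (\<forall>x\<in>C. \<forall>y\<in>C. x \<noteq> y \<longrightarrow> \<theta> \<le> adist x y)"

(* For \<theta> > 0 the sizes of \<theta>-codes on the compact sphere are bounded, so the maximum is taken
   over a finite nonempty set; for \<theta> \<le> 0 and n > 1 the value is meaningless. *)
definition max_code_size :: "nat \<Rightarrow> real \<Rightarrow> nat" where
  "max_code_size n \<theta> = Max {card C |C. spherical_code n \<theta> C}"

definition cos_omega :: "real \<Rightarrow> real \<Rightarrow> real \<Rightarrow> real" where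
  "cos_omega \<theta> \<alpha> \<beta> = (cos \<theta> - cos \<alpha> * cos \<beta>) / (sin \<alpha> * sin \<beta>)"

(* An angle with this cosine exists exactly when the denominator is nonzero and the quotient
   lies in [-1, 1]; otherwise the value of omega below is meaningless. *)
definition omega_defined :: "real \<Rightarrow> real \<Rightarrow> real \<Rightarrow> bool" where
  "omega_defined \<theta> \<alpha> \<beta> \<longleftrightarrow> sin \<alpha> * sin \<beta> \<noteq> 0 \<and> \<bar>cos_omega \<theta> \<alpha> \<beta>\<bar> \<le> 1"

definition omega :: "real \<Rightarrow> real \<Rightarrow> real \<Rightarrow> real" where
  "omega \<theta> \<alpha> \<beta> = arccos (cos_omega \<theta> \<alpha> \<beta>)"

end

theory Submission
  imports Defs
begin

text \<open>
  Both inequalities come from moving the code to another sphere and counting there.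
  Write a point of the sphere as \<open>(u, h)\<close> with \<open>h\<close> its last coordinate and \<open>u\<close> its horizontal part,
  and let \<open>a = arccos h\<close> be its polar angle, so that \<open>u\<close> has length \<open>sin a\<close>.

  For the second inequality, stretch the cap linearly onto a closed hemisphere: keep the direction
  of \<open>u\<close> and replace the polar angle \<open>a\<close> by \<open>a' = a \<pi> / (2 \<phi>)\<close>. The squared chord between two points
  of polar angles \<open>a\<close> and \<open>b\<close> is twice the sum of \<open>1 - cos (a - b)\<close> and
  \<open>sin a sin b - \<langle>u, v\<rangle>\<close>. The single inequality \<open>sin (\<kappa> s) \<le> sin (\<kappa> \<pi>/2) sin s\<close>
  (lemma \<open>sin_scaled_le\<close>), used with \<open>\<kappa> = 2 \<phi> / \<pi>\<close>, shows that each summand is at most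
  \<open>sin\<^sup>2 \<phi>\<close> times the corresponding summand for the stretched points. Hence stretching multiplies
  squared chords by at least \<open>1 / sin\<^sup>2 \<phi>\<close> (lemma \<open>stretch_expands\<close>), which by
  \<open>1 - cos \<omega>\<^sub>1 = (1 - cos \<theta>) / sin\<^sup>2 \<phi>\<close> turns a \<open>\<theta>\<close>-code into an \<open>\<omega>\<^sub>1\<close>-code.
  The condition \<open>a \<le> \<psi>\<close> says precisely that the stretched point is at distance at least
  \<open>\<omega>\<^sub>1\<close> from its mirror image in the equator. So the images of the points of \<open>C(\<psi>)\<close> may be
  joined by their mirror images, which accounts for the factor 2.

  For the first inequality, project the strip radially from the axis onto the equator, sending
  \<open>(u, h)\<close> to \<open>u / sin a\<close>. The cosine of the angle between two projected points is at most
  \<open>(cos \<theta> - cos a cos b) / (sin a sin b)\<close>. Fixing one angle, this expression has its maximum over an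
  interval at an end point (lemma \<open>sinusoid_ge_between\<close>), so over the square \<open>[\<psi>, \<phi>]\<^sup>2\<close> it is maximal
  at a corner; on the diagonal it is increasing, which leaves \<open>cos \<omega>\<^sub>1\<close> and \<open>cos \<omega>\<^sub>2\<close>.

  In both cases the angle of the target code has to be positive, to make the maximum in
  \<open>max_code_size\<close> one over a finite set. For \<open>\<omega>\<^sub>2\<close> this means \<open>\<phi> - \<psi> < \<theta>\<close>, which is again a
  consequence of \<open>sin_scaled_le\<close>.
\<close>

section \<open>Trigonometric inequalities\<close>

text \<open>
  The quotient \<open>sin (k s) / sin s\<close> increases up to \<open>s = \<pi>/2\<close>: the numerator of its derivative
  vanishes at 0 and has derivative \<open>(1 - k\<^sup>2) sin (k s) sin s \<ge> 0\<close>.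
\<close>

lemma sin_scaled_le:
  fixes k s :: real
  assumes "0 \<le> k" "k \<le> 1" "0 \<le> s" "s \<le> pi / 2"
  shows "sin (k * s) \<le> sin (k * (pi / 2)) * sin s"
proof (cases "s = 0")
  case False
  have num_nonneg: "0 \<le> k * cos (k * x) * sin x - sin (k * x) * cos x"
    if x: "0 \<le> x" "x \<le> pi / 2" for x
  proof -
    let ?h = "\<lambda>x. k * cos (k * x) * sin x - sin (k * x) * cos x"
    have "?h 0 \<le> ?h x"
    proof (rule DERIV_nonneg_imp_nondecreasing[OF x(1)])
      fix y assume y: "0 \<le> y" "y \<le> x"
      have "(?h has_real_derivative (1 - k\<^sup>2) * (sin (k * y) * sin y)) (at y)"
        by (auto intro!: derivative_eq_intros simp: algebra_simps power2_eq_square)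
      moreover have "k * y \<le> pi"
        using mult_mono[of k 1 y pi] assms y x pi_gt_zero by auto
      then have "0 \<le> (1 - k\<^sup>2) * (sin (k * y) * sin y)"
        using assms y x by (intro mult_nonneg_nonneg sin_ge_zero) (auto simp: power_le_one)
      ultimately show "\<exists>D. (?h has_real_derivative D) (at y) \<and> 0 \<le> D" by blast
    qed
    then show ?thesis by simp
  qed
  have "sin (k * s) / sin s \<le> sin (k * (pi / 2)) / sin (pi / 2)"
  proof (rule DERIV_nonneg_imp_nondecreasing[OF assms(4)])
    fix x assume x: "s \<le> x" "x \<le> pi / 2"
    have pos: "0 < sin x" using x False assms by (intro sin_gt_zero) auto
    have "((\<lambda>x. sin (k * x) / sin x) has_real_derivative
             (k * cos (k * x) * sin x - sin (k * x) * cos x) / (sin x)\<^sup>2) (at x)"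
      using pos by (auto intro!: derivative_eq_intros simp: algebra_simps power2_eq_square)
    moreover have "0 \<le> (k * cos (k * x) * sin x - sin (k * x) * cos x) / (sin x)\<^sup>2"
      using num_nonneg[of x] x assms by (intro divide_nonneg_nonneg) auto
    ultimately show "\<exists>D. ((\<lambda>x. sin (k * x) / sin x) has_real_derivative D) (at x) \<and> 0 \<le> D"
      by blast
  qed
  moreover have "0 < sin s" using False assms by (intro sin_gt_zero) auto
  ultimately show ?thesis by (simp add: divide_simps split: if_splits)
qed simp

lemma one_minus_cos_scaled_le:
  fixes k u :: real
  assumes "0 \<le> k" "k \<le> 1" "\<bar>u\<bar> \<le> pi"
  shows "1 - cos (k * u) \<le> (sin (k * (pi / 2)))\<^sup>2 * (1 - cos u)"
proof -
  have half: "1 - cos x = 2 * (sin (x / 2))\<^sup>2" for x :: real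
    using cos_double_sin[of "x / 2"] by simp
  have le: "sin (k * (\<bar>u\<bar> / 2)) \<le> sin (k * (pi / 2)) * sin (\<bar>u\<bar> / 2)"
    using assms by (intro sin_scaled_le) auto
  have "k * (\<bar>u\<bar> / 2) \<le> pi"
    using mult_mono[of k 1 "\<bar>u\<bar> / 2" pi] assms pi_gt_zero by auto
  then have "0 \<le> sin (k * (\<bar>u\<bar> / 2))" using assms by (intro sin_ge_zero) auto
  with le have "(sin (k * \<bar>u\<bar> / 2))\<^sup>2 \<le> (sin (k * (pi / 2)))\<^sup>2 * (sin (\<bar>u\<bar> / 2))\<^sup>2"
    using power_mono[OF le, of 2] by (simp add: power_mult_distrib)
  moreover have "(sin (k * \<bar>u\<bar> / 2))\<^sup>2 = (sin (k * u / 2))\<^sup>2" "(sin (\<bar>u\<bar> / 2))\<^sup>2 = (sin (u / 2))\<^sup>2"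
    by (cases "0 \<le> u"; simp)+
  ultimately show ?thesis by (simp add: half)
qed

text \<open>
  Where a sinusoid is nonnegative it is concave, in the quantitative form
  \<open>sin (u - l) f(b) = sin (u - b) f(l) + sin (b - l) f(u)\<close>. If the coefficient of the sine is
  negative, the function is decreasing instead.
\<close>

lemma sinusoid_ge_between:
  fixes M B c l u b :: real
  assumes "0 \<le> l" "l \<le> b" "b \<le> u" "u \<le> pi / 2" "0 \<le> B"
    and l: "c \<le> M * sin l + B * cos l" and u: "c \<le> M * sin u + B * cos u"
  shows "c \<le> M * sin b + B * cos b"
proof (cases "M < 0")
  case True
  have "sin b \<le> sin u" "cos u \<le> cos b"
    using assms by (intro sin_monotone_2pi_le cos_monotone_0_pi_le; simp)+
  then have "M * sin u \<le> M * sin b" "B * cos u \<le> B * cos b"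
    using True assms by (auto intro: mult_left_mono mult_left_mono_neg)
  with u show ?thesis by simp
next
  case False
  let ?f = "\<lambda>x. M * sin x + B * cos x"
  have trig: "0 \<le> sin b" "0 \<le> cos b"
    using assms by (intro sin_ge_zero cos_ge_zero; simp)+
  show ?thesis
  proof (cases "c < 0 \<or> l = u")
    case True
    then show ?thesis
    proof
      assume "c < 0"
      moreover have "0 \<le> ?f b" using False trig assms by simp
      ultimately show ?thesis by simp
    next
      assume "l = u"
      then show ?thesis using assms by simp
    qed
  next
    case c: False
    let ?p = "u - b" and ?q = "b - l"
    have nonneg: "0 \<le> sin ?p" "0 \<le> sin ?q" using assms by (intro sin_ge_zero; simp)+
    have pos: "0 < sin (u - l)" using assms c by (intro sin_gt_zero) auto
    have id: "sin (u - l) * ?f b = sin ?p * ?f l + sin ?q * ?f u"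
    proof -
      have "sin (u - l) * sin b = sin ?p * sin l + sin ?q * sin u"
        by (simp add: sin_diff algebra_simps)
      moreover have "sin (u - l) * cos b = sin ?p * cos l + sin ?q * cos u"
        by (simp add: sin_diff algebra_simps)
      ultimately show ?thesis by (simp add: algebra_simps)
    qed
    have "sin (u - l) = sin ?p * cos ?q + cos ?p * sin ?q"
      using sin_add[of ?p ?q] by simp
    also have "\<dots> \<le> sin ?p + sin ?q"
      using mult_left_mono[OF cos_le_one nonneg(1), of ?q]
        mult_right_mono[OF cos_le_one nonneg(2), of ?p] by simp
    finally have "sin (u - l) * c \<le> (sin ?p + sin ?q) * c" using c by (intro mult_right_mono) auto
    also have "\<dots> \<le> sin ?p * ?f l + sin ?q * ?f u"
      using mult_left_mono[OF l nonneg(1)] mult_left_mono[OF u nonneg(2)]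
      by (simp add: distrib_right)
    finally have "sin (u - l) * c \<le> sin (u - l) * ?f b" using id by simp
    then show ?thesis using pos by simp
  qed
qed

text \<open>
  If two points of polar angles \<open>a\<close> and \<open>b\<close> have longitudes differing by an angle of cosine \<open>K\<close>, the
  cosine of their distance is \<open>K sin a sin b + cos a cos b\<close>. This form of the corner principle
  avoids dividing by \<open>sin a sin b\<close>.
\<close>

lemma spherical_cosine_ge_on_square:
  fixes K c p q a b :: real
  assumes "0 \<le> p" "q \<le> pi / 2" "p \<le> a" "a \<le> q" "p \<le> b" "b \<le> q"
    and pp: "c \<le> K * (sin p * sin p) + cos p * cos p"
    and qp: "c \<le> K * (sin q * sin p) + cos q * cos p"
    and qq: "c \<le> K * (sin q * sin q) + cos q * cos q"
  shows "c \<le> K * (sin a * sin b) + cos a * cos b"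
proof -
  have between: "c \<le> K * (sin x * sin y) + cos x * cos y"
    if "p \<le> x" "x \<le> q" "p \<le> y" "y \<le> q"
      and "c \<le> K * (sin x * sin p) + cos x * cos p"
      and "c \<le> K * (sin x * sin q) + cos x * cos q" for x y
    using sinusoid_ge_between[of p y q "cos x" c "K * sin x"] that assms
    by (simp add: mult.assoc cos_ge_zero)
  have "c \<le> K * (sin p * sin a) + cos p * cos a"
    using between[of p a] pp qp assms by (simp add: mult.commute)
  moreover have "c \<le> K * (sin q * sin a) + cos q * cos a"
    using between[of q a] qq qp assms by simp
  ultimately show ?thesis using between[of a b] assms by (simp add: mult.commute)
qed

section \<open>Sizes of spherical codes\<close>

lemma scalar_prod_le_cos_imp_adist_ge:
  assumes "- 1 \<le> x \<bullet> y" "0 \<le> \<theta>" "\<theta> \<le> pi" "x \<bullet> y \<le> cos \<theta>"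
  shows "\<theta> \<le> adist x y"
  using arccos_le_arccos[of "x \<bullet> y" "cos \<theta>"] assms by (simp add: adist_def arccos_cos)

lemma scalar_prod_sq_sum:
  assumes "x \<in> carrier_vec n" "y \<in> carrier_vec n"
  shows "(\<Sum>i<n. (s * x $ i - t * y $ i)\<^sup>2) =
           s\<^sup>2 * (x \<bullet> x) + t\<^sup>2 * (y \<bullet> y) - 2 * s * t * (x \<bullet> y :: real)"
  using assms
  by (simp add: scalar_prod_def power2_eq_square algebra_simps sum.distrib sum_subtractf
      sum_distrib_left atLeast0LessThan)

lemma usphere_scalar_prod_bounds:
  assumes "x \<in> usphere n" "y \<in> usphere n"
  shows "- 1 \<le> x \<bullet> y" "x \<bullet> y \<le> 1"
proof -
  have nonneg: "0 \<le> (\<Sum>i<n. (s * x $ i - t * y $ i)\<^sup>2)" for s t by (intro sum_nonneg) simp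
  show "- 1 \<le> x \<bullet> y" "x \<bullet> y \<le> 1"
    using nonneg[of 1 "-1"] nonneg[of 1 1] assms
    by (auto simp: usphere_def scalar_prod_sq_sum simp del: mult_minus_left mult_minus1 mult_1)
qed

lemma adist_ge_imp_scalar_prod_le_cos:
  assumes "x \<in> usphere n" "y \<in> usphere n" "0 \<le> \<theta>" "\<theta> \<le> adist x y"
  shows "x \<bullet> y \<le> cos \<theta>"
proof -
  have "- 1 \<le> x \<bullet> y" "x \<bullet> y \<le> 1" using usphere_scalar_prod_bounds assms by blast+
  then show ?thesis
    using cos_monotone_0_pi_le[of \<theta> "arccos (x \<bullet> y)"] assms
    by (simp add: adist_def arccos_ubound)
qed

text \<open>
  Cut space into cubes of side \<open>1 / M\<close>. Only finitely many meet the sphere, and for large \<open>M\<close> two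
  points of the sphere in one cube are closer than the angle \<open>\<theta>\<close>.
\<close>

lemma spherical_code_card_bounded:
  assumes "0 < \<theta>" "\<theta> \<le> pi"
  shows "\<exists>N. \<forall>C. spherical_code n \<theta> C \<longrightarrow> card C \<le> N"
proof -
  have "cos \<theta> < 1" using cos_monotone_0_pi[of 0 \<theta>] assms by simp
  (* The squared distance of two points in one cube of side 1/M is at most n / M^2, while
     points at angle theta have squared distance 2 (1 - cos theta). *)
  obtain M0 :: nat where M0: "real n / (2 * (1 - cos \<theta>)) < real M0" using reals_Archimedean2 by blast
  define M where "M = real (Suc M0)"
  have M: "1 \<le> M" "real n / (2 * (1 - cos \<theta>)) < M" using M0 by (auto simp: M_def)
  have "M \<le> M\<^sup>2" using M by (simp add: power2_eq_square)
  then have fine: "real n / M\<^sup>2 < 2 * (1 - cos \<theta>)"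
  proof -
    have "real n < M * (2 * (1 - cos \<theta>))" using M \<open>cos \<theta> < 1\<close> by (simp add: field_simps)
    also have "\<dots> \<le> M\<^sup>2 * (2 * (1 - cos \<theta>))"
      using \<open>M \<le> M\<^sup>2\<close> \<open>cos \<theta> < 1\<close> by (intro mult_right_mono) auto
    finally show ?thesis using M by (simp add: field_simps)
  qed
  define cell where "cell = (\<lambda>x. restrict (\<lambda>i. \<lfloor>M * x $ i\<rfloor>) {..<n})"
  define cells where "cells = (\<Pi>\<^sub>E i\<in>{..<n}. {\<lfloor>- M\<rfloor>..\<lfloor>M\<rfloor>})"
  have fin: "finite cells" unfolding cells_def by (intro finite_PiE) auto
  have coord: "\<bar>x $ i\<bar> \<le> 1" if "x \<in> usphere n" "i < n" for x i
  proof -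
    have "(x $ i)\<^sup>2 \<le> (\<Sum>i<n. (x $ i)\<^sup>2)" using that by (intro member_le_sum) auto
    also have "\<dots> = 1" using that
      by (auto simp: usphere_def scalar_prod_def power2_eq_square atLeast0LessThan)
    finally show ?thesis by (simp add: abs_square_le_1)
  qed
  have cell_in: "cell x \<in> cells" if "x \<in> usphere n" for x
  proof -
    have "- M \<le> M * x $ i" "M * x $ i \<le> M" if "i < n" for i
      using mult_left_mono[of "- 1" "x $ i" M] mult_left_mono[of "x $ i" 1 M]
        coord[OF \<open>x \<in> usphere n\<close> that] M by auto
    then show ?thesis by (auto simp: cell_def cells_def intro!: floor_mono)
  qed
  have same: "cos \<theta> < x \<bullet> y" if xy: "x \<in> usphere n" "y \<in> usphere n" "cell x = cell y" for x y
  proof -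
    have "(x $ i - y $ i)\<^sup>2 \<le> 1 / M\<^sup>2" if "i < n" for i
    proof -
      have "\<lfloor>M * x $ i\<rfloor> = \<lfloor>M * y $ i\<rfloor>"
        using fun_cong[OF xy(3), of i] that by (simp add: cell_def)
      then have "\<bar>M * x $ i - M * y $ i\<bar> \<le> 1" by linarith
      then have "(M * x $ i - M * y $ i)\<^sup>2 \<le> 1" by (simp add: abs_square_le_1)
      moreover have "(M * x $ i - M * y $ i)\<^sup>2 = (x $ i - y $ i)\<^sup>2 * M\<^sup>2"
        by (simp add: power2_eq_square algebra_simps)
      ultimately show ?thesis using M by (simp add: field_simps)
    qed
    then have "(\<Sum>i<n. (x $ i - y $ i)\<^sup>2) \<le> (\<Sum>i<n. 1 / M\<^sup>2)" by (intro sum_mono) auto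
    then have "2 - 2 * (x \<bullet> y) \<le> real n / M\<^sup>2"
      using scalar_prod_sq_sum[of x n y 1 1] xy by (simp add: usphere_def)
    with fine show ?thesis by argo
  qed
  have "card C \<le> card cells" if C: "spherical_code n \<theta> C" for C
  proof (rule card_inj_on_le[OF _ _ fin])
    show "inj_on cell C"
    proof (rule inj_onI, rule ccontr)
      fix x y assume xy: "x \<in> C" "y \<in> C" "cell x = cell y" "x \<noteq> y"
      then have "x \<in> usphere n" "y \<in> usphere n" "\<theta> \<le> adist x y"
        using C by (auto simp: spherical_code_def)
      then show False
        using same[of x y] adist_ge_imp_scalar_prod_le_cos[of x n y \<theta>] xy assms by simp
    qed
    show "cell ` C \<subseteq> cells" using C cell_in by (auto simp: spherical_code_def)
  qed
  then show ?thesis by blast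
qed

text \<open>
  Positivity of the angle makes a family with pairwise small inner products injective, so that it can
  be counted through its index set.
\<close>

lemma card_le_max_code_size:
  assumes "0 < \<omega>" "\<omega> \<le> pi" "finite I"
    and sphere: "\<And>i. i \<in> I \<Longrightarrow> f i \<in> usphere n"
    and sep: "\<And>i j. i \<in> I \<Longrightarrow> j \<in> I \<Longrightarrow> i \<noteq> j \<Longrightarrow> f i \<bullet> f j \<le> cos \<omega>"
  shows "card I \<le> max_code_size n \<omega>"
proof -
  have "cos \<omega> < 1" using cos_monotone_0_pi[of 0 \<omega>] assms by simp
  have inj: "inj_on f I"
  proof (rule inj_onI, rule ccontr)
    fix i j assume ij: "i \<in> I" "j \<in> I" "f i = f j" "i \<noteq> j"
    then have "f i \<bullet> f j = 1" using sphere[of i] by (auto simp: usphere_def)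
    then show False using sep[of i j] ij \<open>cos \<omega> < 1\<close> by simp
  qed
  have code: "spherical_code n \<omega> (f ` I)"
    unfolding spherical_code_def
  proof (intro conjI ballI impI)
    fix x y assume "x \<in> f ` I" "y \<in> f ` I" "x \<noteq> y"
    then obtain i j where ij: "i \<in> I" "j \<in> I" "i \<noteq> j" "x = f i" "y = f j" by blast
    then show "\<omega> \<le> adist x y"
      using usphere_scalar_prod_bounds[of "f i" n "f j"] sphere sep assms
      by (intro scalar_prod_le_cos_imp_adist_ge) auto
  qed (use assms in auto)
  obtain N where N: "\<And>C. spherical_code n \<omega> C \<Longrightarrow> card C \<le> N"
    using spherical_code_card_bounded[of \<omega> n] assms by blast
  have "finite {card C |C. spherical_code n \<omega> C}"
    by (rule finite_subset[of _ "{..N}"]) (use N in auto)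
  then have "card (f ` I) \<le> max_code_size n \<omega>"
    unfolding max_code_size_def using code by (intro Max_ge) auto
  then show ?thesis by (simp add: card_image inj)
qed

section \<open>Cylindrical coordinates on the sphere\<close>

definition horizontal :: "nat \<Rightarrow> real vec \<Rightarrow> real vec" where
  "horizontal m x = vec m (\<lambda>i. x $ i)"

definition polar :: "nat \<Rightarrow> real vec \<Rightarrow> real" where
  "polar m x = arccos (x $ m)"

definition with_height :: "nat \<Rightarrow> real vec \<Rightarrow> real \<Rightarrow> real vec" where
  "with_height m u h = vec (Suc m) (\<lambda>i. if i < m then u $ i else h)"

lemma horizontal_carrier [simp]: "horizontal m x \<in> carrier_vec m"
  by (simp add: horizontal_def)

lemma scaled_horizontal_scalar_prod:
  "(s \<cdot>\<^sub>v horizontal m x) \<bullet> (t \<cdot>\<^sub>v horizontal m y) = s * t * (horizontal m x \<bullet> horizontal m y)"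
  using smult_scalar_prod_distrib[of "horizontal m x" m "t \<cdot>\<^sub>v horizontal m y" s]
    scalar_prod_smult_distrib[of "horizontal m x" m "horizontal m y" t] by simp

lemma with_height_scalar_prod:
  assumes "u \<in> carrier_vec m" "v \<in> carrier_vec m"
  shows "with_height m u h \<bullet> with_height m v k = u \<bullet> v + h * k"
  using assms by (simp add: scalar_prod_def with_height_def)

lemma with_height_carrier [simp]: "with_height m u h \<in> carrier_vec (Suc m)"
  by (simp add: with_height_def)

lemma scalar_prod_split:
  assumes "x \<in> carrier_vec (Suc m)" "y \<in> carrier_vec (Suc m)"
  shows "x \<bullet> y = horizontal m x \<bullet> horizontal m y + x $ m * y $ m"
  using assms by (simp add: scalar_prod_def horizontal_def)

lemma polar_coordinates:
  assumes "x \<in> usphere (Suc m)"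
  shows "cos (polar m x) = x $ m" "0 \<le> polar m x" "polar m x \<le> pi"
    and "horizontal m x \<bullet> horizontal m x = (sin (polar m x))\<^sup>2"
proof -
  have x: "x \<in> carrier_vec (Suc m)" "x \<bullet> x = 1" using assms by (auto simp: usphere_def)
  have "0 \<le> horizontal m x \<bullet> horizontal m x"
    by (simp add: scalar_prod_def sum_nonneg)
  then have "(x $ m)\<^sup>2 \<le> 1" using scalar_prod_split[of x m x] x by (simp add: power2_eq_square)
  then have "\<bar>x $ m\<bar> \<le> 1" by (simp add: abs_square_le_1)
  then show c: "cos (polar m x) = x $ m" and "0 \<le> polar m x" "polar m x \<le> pi"
    by (auto simp: polar_def cos_arccos_abs abs_le_iff intro!: arccos_lbound arccos_ubound)
  show "horizontal m x \<bullet> horizontal m x = (sin (polar m x))\<^sup>2"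
    using scalar_prod_split[of x m x] x unfolding sin_squared_eq c by (simp add: power2_eq_square)
qed

lemma horizontal_eq_0:
  assumes "x \<in> usphere (Suc m)" "sin (polar m x) = 0"
  shows "horizontal m x = 0\<^sub>v m"
  using polar_coordinates(4)[OF assms(1)] assms(2) horizontal_carrier[of m x]
  by (auto simp: scalar_prod_def sum_nonneg_eq_0_iff)

lemma horizontal_Cauchy_Schwarz:
  assumes "x \<in> usphere (Suc m)" "y \<in> usphere (Suc m)"
  shows "horizontal m x \<bullet> horizontal m y \<le> sin (polar m x) * sin (polar m y)"
proof -
  let ?u = "horizontal m x" and ?v = "horizontal m y"
  define a where "a = sin (polar m x)"
  define b where "b = sin (polar m y)"
  have ab: "0 \<le> a" "0 \<le> b" "?u \<bullet> ?u = a\<^sup>2" "?v \<bullet> ?v = b\<^sup>2"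
    using polar_coordinates[OF assms(1)] polar_coordinates[OF assms(2)]
    by (auto simp: a_def b_def intro!: sin_ge_zero)
  show ?thesis
  proof (cases "a = 0 \<or> b = 0")
    case True
    then have "?u \<bullet> ?v = 0" using horizontal_eq_0 assms by (auto simp: a_def b_def)
    then show ?thesis using True by (auto simp flip: a_def b_def)
  next
    case False
    then have pos: "0 < a * b" using ab by simp
    have "0 \<le> (\<Sum>i<m. (b * ?u $ i - a * ?v $ i)\<^sup>2)" by (intro sum_nonneg) simp
    then have "(a * b) * (?u \<bullet> ?v) \<le> (a * b) * (a * b)"
      using scalar_prod_sq_sum[of ?u m ?v b a] ab by (simp add: power2_eq_square algebra_simps)
    then have "?u \<bullet> ?v \<le> a * b" using pos by (simp only: mult_le_cancel_left_pos)
    then show ?thesis by (simp add: a_def b_def)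
  qed
qed

lemma strip_polar:
  assumes "x \<in> strip (Suc m) \<alpha> \<beta>" "0 \<le> \<alpha>" "\<alpha> \<le> pi" "0 \<le> \<beta>" "\<beta> \<le> pi"
  shows "x \<in> usphere (Suc m)" "\<alpha> \<le> polar m x" "polar m x \<le> \<beta>"
proof -
  show x: "x \<in> usphere (Suc m)" using assms by (simp add: strip_def)
  then have "cos \<beta> \<le> cos (polar m x)" "cos (polar m x) \<le> cos \<alpha>"
    using assms by (auto simp: strip_def usphere_def polar_coordinates(1)[OF x])
  then show "\<alpha> \<le> polar m x" "polar m x \<le> \<beta>"
    using polar_coordinates(2,3)[OF x] assms by (auto simp: cos_mono_le_eq)
qed

section \<open>Stretching the cap onto a hemisphere\<close>

text \<open>
  At the pole \<open>sin (polar m x)\<close> is 0, and the value 0 of the quotient is the right one since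
  the horizontal part vanishes there. The sign \<open>\<epsilon> = -1\<close> gives the mirror image in the equator.
\<close>

definition stretch :: "nat \<Rightarrow> real \<Rightarrow> real \<Rightarrow> real vec \<Rightarrow> real vec" where
  "stretch m r \<epsilon> x =
     with_height m ((sin (r * polar m x) / sin (polar m x)) \<cdot>\<^sub>v horizontal m x)
       (\<epsilon> * cos (r * polar m x))"

lemma stretch_scalar_prod:
  "stretch m r \<epsilon> x \<bullet> stretch m r \<delta> y =
     sin (r * polar m x) / sin (polar m x) * (sin (r * polar m y) / sin (polar m y)) *
       (horizontal m x \<bullet> horizontal m y)
     + \<epsilon> * \<delta> * (cos (r * polar m x) * cos (r * polar m y))"
  unfolding stretch_def
  by (subst with_height_scalar_prod) (auto simp: scaled_horizontal_scalar_prod)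

lemma stretch_self_scalar_prod:
  assumes "x \<in> usphere (Suc m)" "polar m x < pi"
  shows "stretch m r \<epsilon> x \<bullet> stretch m r \<delta> x =
           (sin (r * polar m x))\<^sup>2 + \<epsilon> * \<delta> * (cos (r * polar m x))\<^sup>2"
proof -
  have "sin (polar m x) = 0 \<Longrightarrow> polar m x = 0"
    using sin_gt_zero[of "polar m x"] polar_coordinates(2)[OF assms(1)] assms(2) by fastforce
  then show ?thesis
    using polar_coordinates(4)[OF assms(1)]
    by (cases "sin (polar m x) = 0") (auto simp: stretch_scalar_prod power2_eq_square)
qed

lemma stretch_in_usphere:
  assumes "x \<in> usphere (Suc m)" "polar m x < pi" "\<epsilon> * \<epsilon> = 1"
  shows "stretch m r \<epsilon> x \<in> usphere (Suc m)"
  using stretch_self_scalar_prod[OF assms(1,2), of r \<epsilon> \<epsilon>] assms(3)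
  by (simp add: usphere_def stretch_def)

text \<open>
  Both summands of \<open>1 - \<langle>x, y\<rangle> = (1 - cos (a - b)) + (sin a sin b - \<langle>u, v\<rangle>)\<close> grow by at least the
  factor \<open>1 / sin\<^sup>2 \<phi>\<close>. The second is multiplied by \<open>sin a' sin b' / (sin a sin b)\<close>, and it is
  nonnegative by the Cauchy-Schwarz inequality.
\<close>

lemma stretch_expands:
  assumes "x \<in> usphere (Suc m)" "y \<in> usphere (Suc m)"
    and "0 < \<phi>" "\<phi> \<le> pi / 2" "polar m x \<le> \<phi>" "polar m y \<le> \<phi>"
    and r: "r = pi / (2 * \<phi>)"
  shows "1 - x \<bullet> y \<le> (sin \<phi>)\<^sup>2 * (1 - stretch m r 1 x \<bullet> stretch m r 1 y)"
proof -
  define a where "a = polar m x"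
  define b where "b = polar m y"
  define P where "P = horizontal m x \<bullet> horizontal m y"
  let ?A = "r * a" and ?B = "r * b" and ?k = "2 * \<phi> / pi"
  have k: "0 \<le> ?k" "?k \<le> 1" "?k * (pi / 2) = \<phi>" "?k * (r * z) = z" for z
    using assms by (auto simp: field_simps)
  have ab: "0 \<le> a" "0 \<le> b" "a \<le> \<phi>" "b \<le> \<phi>"
    using polar_coordinates(2) assms by (auto simp: a_def b_def)
  have range: "0 \<le> ?A" "0 \<le> ?B" "?A \<le> pi / 2" "?B \<le> pi / 2"
    using ab assms by (auto simp: r field_simps)
  have "1 - cos (a - b) \<le> (sin \<phi>)\<^sup>2 * (1 - cos (?A - ?B))"
    using one_minus_cos_scaled_le[of ?k "?A - ?B"] k(1-3) k(4)[of "a - b"] range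
    by (simp add: right_diff_distrib abs_le_iff)
  moreover have "sin a * sin b - P \<le>
      (sin \<phi>)\<^sup>2 * (sin ?A * sin ?B - sin ?A / sin a * (sin ?B / sin b) * P)"
  proof (cases "sin a = 0 \<or> sin b = 0")
    case True
    then have "a = 0 \<or> b = 0"
      using sin_gt_zero[of a] sin_gt_zero[of b] ab assms(4) by force
    moreover have "P = 0"
      using True horizontal_eq_0 assms(1,2) by (auto simp: P_def a_def b_def)
    ultimately show ?thesis by auto
  next
    case False
    then have pos: "0 < sin a" "0 < sin b" using sin_ge_zero[of a] sin_ge_zero[of b] ab assms by auto
    have le: "sin a \<le> sin \<phi> * sin ?A" "sin b \<le> sin \<phi> * sin ?B"
      using sin_scaled_le[of ?k ?A] sin_scaled_le[of ?k ?B] k(1-3) k(4)[of a] k(4)[of b] range by auto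
    define q where "q = sin ?A / sin a * (sin ?B / sin b)"
    have "1 \<le> (sin \<phi> * sin ?A / sin a) * (sin \<phi> * sin ?B / sin b)"
      using mult_mono[of 1 "sin \<phi> * sin ?A / sin a" 1 "sin \<phi> * sin ?B / sin b"] le pos by simp
    then have q: "1 \<le> (sin \<phi>)\<^sup>2 * q" by (simp add: q_def power2_eq_square mult_ac)
    have "0 \<le> sin a * sin b - P"
      using horizontal_Cauchy_Schwarz assms by (simp add: P_def a_def b_def)
    then have "1 * (sin a * sin b - P) \<le> (sin \<phi>)\<^sup>2 * q * (sin a * sin b - P)"
      by (intro mult_right_mono q)
    moreover have "q * (sin a * sin b) = sin ?A * sin ?B" using False by (simp add: q_def)
    ultimately show ?thesis unfolding q_def[symmetric] by (simp add: right_diff_distrib mult.assoc)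
  qed
  moreover have "x \<bullet> y = P + cos a * cos b"
    using scalar_prod_split[of x m y] polar_coordinates(1) assms
    by (simp add: P_def a_def b_def usphere_def)
  moreover have "stretch m r 1 x \<bullet> stretch m r 1 y =
      sin ?A / sin a * (sin ?B / sin b) * P + cos ?A * cos ?B"
    by (simp add: stretch_scalar_prod P_def a_def b_def)
  ultimately show ?thesis by (simp add: cos_diff algebra_simps)
qed

section \<open>The angles of the two target codes\<close>

lemma omega_diagonal:
  assumes "omega_defined \<theta> \<phi> \<phi>" "0 < \<theta>" "\<theta> \<le> pi"
  shows "0 < omega \<theta> \<phi> \<phi>" "omega \<theta> \<phi> \<phi> \<le> pi"
    and "(sin \<phi>)\<^sup>2 * (1 - cos (omega \<theta> \<phi> \<phi>)) = 1 - cos \<theta>"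
proof -
  have *: "sin \<phi> \<noteq> 0" "\<bar>cos_omega \<theta> \<phi> \<phi>\<bar> \<le> 1" using assms(1) by (auto simp: omega_defined_def)
  have c: "cos (omega \<theta> \<phi> \<phi>) = cos_omega \<theta> \<phi> \<phi>" using * by (simp add: omega_def cos_arccos_abs)
  have "(sin \<phi>)\<^sup>2 * cos_omega \<theta> \<phi> \<phi> = cos \<theta> - (cos \<phi>)\<^sup>2"
    using * by (simp add: cos_omega_def power2_eq_square)
  then show id: "(sin \<phi>)\<^sup>2 * (1 - cos (omega \<theta> \<phi> \<phi>)) = 1 - cos \<theta>"
    by (simp add: c right_diff_distrib sin_squared_eq)
  show "omega \<theta> \<phi> \<phi> \<le> pi" using * by (auto simp: omega_def abs_le_iff intro!: arccos_ubound)
  have "0 \<le> omega \<theta> \<phi> \<phi>" using * by (auto simp: omega_def abs_le_iff intro!: arccos_lbound)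
  moreover have "omega \<theta> \<phi> \<phi> \<noteq> 0"
  proof
    assume "omega \<theta> \<phi> \<phi> = 0"
    then have "cos \<theta> = 1" using id by simp
    then show False using cos_monotone_0_pi[of 0 \<theta>] assms by simp
  qed
  ultimately show "0 < omega \<theta> \<phi> \<phi>" by simp
qed

text \<open>
  In half angles, \<open>sin (\<phi> \<omega>\<^sub>1 / (2 \<pi>)) \<le> sin (\<phi>/2) sin (\<omega>\<^sub>1/2) < sin \<phi> sin (\<omega>\<^sub>1/2) = sin (\<theta>/2)\<close>.
  The left side belongs to the width \<open>\<phi> - \<psi>\<close> of the strip.
\<close>

lemma cos_theta_less_cos_width:
  assumes "omega_defined \<theta> \<phi> \<phi>" "0 < \<theta>" "\<theta> \<le> pi" "0 < \<phi>" "\<phi> \<le> pi / 2"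
    and \<psi>: "\<psi> = \<phi> * (1 - omega \<theta> \<phi> \<phi> / pi)"
  shows "cos \<theta> < cos (\<phi> - \<psi>)"
proof -
  let ?w = "omega \<theta> \<phi> \<phi>" and ?k = "\<phi> / pi"
  note w = omega_diagonal[OF assms(1-3)]
  have k: "0 \<le> ?k" "?k \<le> 1" using assms by (auto simp: field_simps)
  have less: "sin (\<phi> / 2) < sin \<phi>" using assms by (intro sin_monotone_2pi) auto
  moreover have "0 \<le> sin (\<phi> / 2)" using assms by (intro sin_ge_zero) auto
  ultimately have "(sin (\<phi> / 2))\<^sup>2 < (sin \<phi>)\<^sup>2" by (intro power_strict_mono) auto
  moreover have "0 < 1 - cos ?w" using cos_monotone_0_pi[of 0 ?w] w by simp
  ultimately have "(sin (\<phi> / 2))\<^sup>2 * (1 - cos ?w) < 1 - cos \<theta>"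
    unfolding w(3)[symmetric] by (intro mult_strict_right_mono)
  moreover have "1 - cos (?k * ?w) \<le> (sin (?k * (pi / 2)))\<^sup>2 * (1 - cos ?w)"
    using w k by (intro one_minus_cos_scaled_le) auto
  moreover have "?k * ?w = \<phi> - \<psi>" by (simp add: \<psi> field_simps)
  moreover have "?k * (pi / 2) = \<phi> / 2" by simp
  ultimately show ?thesis by simp
qed

section \<open>The two bounds\<close>

lemma strip_code_bound:
  assumes code: "spherical_code (Suc m) \<theta> C"
    and \<theta>: "0 < \<theta>" "\<theta> \<le> pi" and \<phi>: "0 < \<phi>" "\<phi> \<le> pi / 2"
    and def1: "omega_defined \<theta> \<phi> \<phi>" and def2: "omega_defined \<theta> \<phi> \<psi>"
    and \<psi>: "\<psi> = \<phi> * (1 - omega \<theta> \<phi> \<phi> / pi)"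
  shows "card (C \<inter> strip (Suc m) \<psi> \<phi>)
           \<le> max_code_size m (min (omega \<theta> \<phi> \<phi>) (omega \<theta> \<phi> \<psi>))"
proof -
  define w1 where "w1 = omega \<theta> \<phi> \<phi>"
  define w2 where "w2 = omega \<theta> \<phi> \<psi>"
  define K where "K = cos (min w1 w2)"
  note w1 = omega_diagonal[OF def1 \<theta>, folded w1_def]
  have nz: "sin \<phi> * sin \<psi> \<noteq> 0" and co: "\<bar>cos_omega \<theta> \<phi> \<psi>\<bar> \<le> 1"
    using def2 by (auto simp: omega_defined_def)
  have "0 \<le> \<psi>" "\<psi> \<le> \<phi>"
    using \<phi> w1(1,2) by (auto simp: \<psi> field_simps simp flip: w1_def)
  moreover have "\<psi> \<noteq> 0" using nz by auto
  ultimately have range: "0 < \<psi>" "\<psi> \<le> \<phi>" "\<psi> \<le> pi" "\<phi> \<le> pi" using \<phi> by auto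
  have pos: "0 < sin z" if "\<psi> \<le> z" "z \<le> \<phi>" for z using that range \<phi> by (intro sin_gt_zero) auto
  have cw2: "cos w2 = cos_omega \<theta> \<phi> \<psi>" using co by (simp add: w2_def omega_def cos_arccos_abs)
  have ccos: "cos w2 * (sin \<phi> * sin \<psi>) = cos \<theta> - cos \<phi> * cos \<psi>"
    using nz by (simp add: cw2 cos_omega_def)
  have w2: "0 \<le> w2" "w2 \<le> pi"
    using co by (auto simp: w2_def omega_def abs_le_iff intro!: arccos_ubound arccos_lbound)
  have "w2 \<noteq> 0"
    using ccos cos_theta_less_cos_width[OF def1 \<theta> \<phi> \<psi>] by (auto simp: cos_diff)
  then have w: "0 < min w1 w2" "min w1 w2 \<le> pi" using w1 w2 by auto
  have K: "cos w1 \<le> K" "cos w2 \<le> K"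
    using w1 w2 w unfolding K_def by (intro cos_monotone_0_pi_le; simp)+
  have K_ge: "cos \<theta> \<le> K * (sin p * sin q) + cos p * cos q"
    if "\<psi> \<le> p" "p \<le> \<phi>" "\<psi> \<le> q" "q \<le> \<phi>" for p q
  proof (rule spherical_cosine_ge_on_square[of \<psi> \<phi>])
    have diag: "cos \<theta> \<le> K * (sin z * sin z) + cos z * cos z" if "\<psi> \<le> z" "z \<le> \<phi>" for z
    proof -
      have "sin z \<le> sin \<phi>" using that range \<phi> by (intro sin_monotone_2pi_le) auto
      then have "(sin z)\<^sup>2 \<le> (sin \<phi>)\<^sup>2" using pos[OF that] by (intro power_mono) auto
      then have "(sin z)\<^sup>2 * (1 - cos w1) \<le> (sin \<phi>)\<^sup>2 * (1 - cos w1)"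
        by (intro mult_right_mono) auto
      moreover have "(sin z)\<^sup>2 * cos w1 \<le> (sin z)\<^sup>2 * K" using K by (intro mult_left_mono) auto
      ultimately have "(sin z)\<^sup>2 * (1 - K) \<le> 1 - cos \<theta>"
        using w1(3) by (simp add: right_diff_distrib)
      moreover have "cos z * cos z = 1 - (sin z)\<^sup>2"
        by (simp add: cos_squared_eq flip: power2_eq_square)
      ultimately show ?thesis by (simp add: right_diff_distrib power2_eq_square mult.commute[of K])
    qed
    show "cos \<theta> \<le> K * (sin \<psi> * sin \<psi>) + cos \<psi> * cos \<psi>"
      "cos \<theta> \<le> K * (sin \<phi> * sin \<phi>) + cos \<phi> * cos \<phi>" using diag range by auto
    have "cos w2 * (sin \<phi> * sin \<psi>) \<le> K * (sin \<phi> * sin \<psi>)"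
      using K pos[of \<phi>] pos[of \<psi>] range by (intro mult_right_mono) auto
    then show "cos \<theta> \<le> K * (sin \<phi> * sin \<psi>) + cos \<phi> * cos \<psi>" using ccos by simp
  qed (use that range \<phi> in auto)
  let ?I = "C \<inter> strip (Suc m) \<psi> \<phi>"
  let ?f = "\<lambda>x. (1 / sin (polar m x)) \<cdot>\<^sub>v horizontal m x"
  have I: "x \<in> usphere (Suc m)" "\<psi> \<le> polar m x" "polar m x \<le> \<phi>" if "x \<in> ?I" for x
    using strip_polar[of x m \<psi> \<phi>] that range \<phi> by auto
  have f: "?f x \<bullet> ?f y = (horizontal m x \<bullet> horizontal m y) / (sin (polar m x) * sin (polar m y))"
    for x y by (simp add: scaled_horizontal_scalar_prod)
  have "card ?I \<le> max_code_size m (min w1 w2)"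
  proof (rule card_le_max_code_size[OF w, where f = ?f])
    show "finite ?I" using code by (auto simp: spherical_code_def)
    fix x assume x: "x \<in> ?I"
    have px: "0 < sin (polar m x)" using pos I[OF x] by auto
    show "?f x \<in> usphere m"
      using f[of x x] polar_coordinates(4)[OF I(1)[OF x]] px
      by (simp add: usphere_def power2_eq_square)
    fix y assume y: "y \<in> ?I" and ne: "x \<noteq> y"
    have py: "0 < sin (polar m y)" using pos I[OF y] by auto
    have "\<theta> \<le> adist x y" using code x y ne by (auto simp: spherical_code_def)
    then have "x \<bullet> y \<le> cos \<theta>"
      using adist_ge_imp_scalar_prod_le_cos I(1)[OF x] I(1)[OF y] \<theta> by auto
    moreover have "x \<bullet> y = horizontal m x \<bullet> horizontal m y + cos (polar m x) * cos (polar m y)"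
      using scalar_prod_split[of x m y] I(1)[OF x] I(1)[OF y]
      by (simp add: polar_coordinates(1) usphere_def)
    moreover have "cos \<theta> \<le> K * (sin (polar m x) * sin (polar m y)) + cos (polar m x) * cos (polar m y)"
      using K_ge I[OF x] I[OF y] by auto
    ultimately have "horizontal m x \<bullet> horizontal m y \<le> K * (sin (polar m x) * sin (polar m y))"
      by simp
    then show "?f x \<bullet> ?f y \<le> cos (min w1 w2)"
      unfolding f K_def[symmetric] using px py by (simp add: pos_divide_le_eq)
  qed
  then show ?thesis by (simp add: w1_def w2_def)
qed

text \<open>
  The index \<open>(x, 1)\<close> stands for the stretched point and \<open>(x, - 1)\<close> for its mirror image. Moving one
  of two points of the upper hemisphere to the lower one does not increase the inner product, so
  only a point and its own mirror image need the bound on the polar angle.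
\<close>

lemma doubled_code_bound:
  assumes code: "spherical_code (Suc m) \<theta> C" and cap: "C \<subseteq> cap (Suc m) \<phi>"
    and \<theta>: "0 < \<theta>" "\<theta> \<le> pi" and \<phi>: "0 < \<phi>" "\<phi> \<le> pi / 2"
    and def1: "omega_defined \<theta> \<phi> \<phi>"
    and \<psi>: "\<psi> = \<phi> * (1 - omega \<theta> \<phi> \<phi> / pi)"
  shows "card C + card (C \<inter> cap (Suc m) \<psi>) \<le> max_code_size (Suc m) (omega \<theta> \<phi> \<phi>)"
proof -
  define w where "w = omega \<theta> \<phi> \<phi>"
  note w = omega_diagonal[OF def1 \<theta>, folded w_def]
  define r where "r = pi / (2 * \<phi>)"
  have range: "0 \<le> \<psi>" "\<psi> \<le> pi" "\<phi> \<le> pi"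
    using \<phi> w(1,2) mult_mono[of \<phi> pi "1 - w / pi" 1]
    by (auto simp: \<psi> simp flip: w_def)
  have fin: "finite C" using code by (simp add: spherical_code_def)
  have in_C: "x \<in> usphere (Suc m)" "0 \<le> polar m x" "polar m x \<le> \<phi>" "polar m x < pi" if "x \<in> C" for x
    using strip_polar[of x m 0 \<phi>] that cap \<phi> range by (auto simp: cap_def)
  have in_hemisphere: "0 \<le> r * polar m x" "r * polar m x \<le> pi / 2" if "x \<in> C" for x
    using in_C[OF that] \<phi> by (auto simp: r_def field_simps)
  let ?J = "C \<inter> cap (Suc m) \<psi>"
  let ?I = "C \<times> {1} \<union> ?J \<times> {- 1 :: real}"
  let ?f = "\<lambda>(x, \<epsilon>). stretch m r \<epsilon> x"
  have same: "stretch m r 1 x \<bullet> stretch m r 1 y \<le> cos w" if "x \<in> C" "y \<in> C" "x \<noteq> y" for x y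
  proof -
    have "\<theta> \<le> adist x y" using code that by (auto simp: spherical_code_def)
    then have "x \<bullet> y \<le> cos \<theta>" using adist_ge_imp_scalar_prod_le_cos[OF in_C(1) in_C(1)] that \<theta> by simp
    moreover have "1 - x \<bullet> y \<le> (sin \<phi>)\<^sup>2 * (1 - stretch m r 1 x \<bullet> stretch m r 1 y)"
      using in_C that \<phi> by (intro stretch_expands) (auto simp: r_def)
    ultimately have "(sin \<phi>)\<^sup>2 * (1 - cos w) \<le> (sin \<phi>)\<^sup>2 * (1 - stretch m r 1 x \<bullet> stretch m r 1 y)"
      using w(3) by simp
    moreover have "0 < sin \<phi>" using \<phi> by (intro sin_gt_zero) auto
    ultimately show ?thesis by simp
  qed
  have mirror: "stretch m r 1 x \<bullet> stretch m r (- 1) x \<le> cos w" if x: "x \<in> ?J" for x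
  proof -
    have "polar m x \<le> \<psi>" using strip_polar[of x m 0 \<psi>] x range by (auto simp: cap_def)
    then have "r * polar m x \<le> r * \<psi>" using \<phi> by (intro mult_left_mono) (auto simp: r_def)
    also have "r * \<psi> = (pi - w) / 2" using \<phi> by (simp add: r_def \<psi> w_def field_simps)
    finally have "w \<le> pi - 2 * (r * polar m x)" by simp
    then have "cos (pi - 2 * (r * polar m x)) \<le> cos w"
      using w in_hemisphere[of x] x by (intro cos_monotone_0_pi_le) auto
    moreover have "stretch m r 1 x \<bullet> stretch m r (- 1) x = - cos (2 * (r * polar m x))"
      using stretch_self_scalar_prod[of x m r 1 "- 1"] in_C[of x] x by (simp add: cos_double)
    ultimately show ?thesis by simp
  qed
  have sep: "stretch m r \<epsilon> x \<bullet> stretch m r \<delta> y \<le> cos w"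
    if "x \<in> C" "y \<in> C" "x \<noteq> y" "\<epsilon> * \<delta> \<le> 1" for x y \<epsilon> \<delta>
  proof -
    have "0 \<le> cos (r * polar m x) * cos (r * polar m y)"
      using in_hemisphere[OF that(1)] in_hemisphere[OF that(2)]
      by (intro mult_nonneg_nonneg cos_ge_zero) auto
    from mult_right_mono[OF that(4) this]
    have "stretch m r \<epsilon> x \<bullet> stretch m r \<delta> y \<le> stretch m r 1 x \<bullet> stretch m r 1 y"
      by (simp add: stretch_scalar_prod)
    with same[OF that(1-3)] show ?thesis by simp
  qed
  have "card ?I \<le> max_code_size (Suc m) w"
  proof (rule card_le_max_code_size[OF w(1,2), where f = ?f])
    show "finite ?I" using fin by simp
    fix i assume i: "i \<in> ?I"
    then show "?f i \<in> usphere (Suc m)" using in_C by (auto intro!: stretch_in_usphere)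
    fix j assume j: "j \<in> ?I" and ne: "i \<noteq> j"
    obtain x \<epsilon> y \<delta> where ij: "i = (x, \<epsilon>)" "j = (y, \<delta>)" by (cases i, cases j)
    show "?f i \<bullet> ?f j \<le> cos w"
    proof (cases "x = y")
      case True
      have "stretch m r (- 1) x \<bullet> stretch m r 1 x = stretch m r 1 x \<bullet> stretch m r (- 1) x"
        by (simp add: stretch_scalar_prod)
      then show ?thesis using True ij i j ne mirror[of x] by auto
    next
      case False
      then show ?thesis using sep[of x y \<epsilon> \<delta>] ij i j by auto
    qed
  qed
  moreover have "card ?I = card C + card ?J"
    using fin by (subst card_Un_disjoint) (auto simp: card_cartesian_product)
  ultimately show ?thesis by (simp add: w_def)
qed

theorem theorem10:
  fixes n :: nat and \<theta> \<phi> \<psi> \<omega>\<^sub>1 \<omega>\<^sub>2 :: real and C :: "real vec set"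
  assumes "n \<ge> 2"
    and "0 < \<theta>" and "\<theta> \<le> pi"
    and "0 \<le> \<phi>" and "\<phi> \<le> pi / 2"
    and "omega_defined \<theta> \<phi> \<phi>"
    and "\<omega>\<^sub>1 = omega \<theta> \<phi> \<phi>"
    and "\<psi> = \<phi> * (1 - \<omega>\<^sub>1 / pi)"
    and "\<omega>\<^sub>2 = omega \<theta> \<phi> \<psi>"
    and "spherical_code n \<theta> C"
    and "C \<subseteq> cap n \<phi>"
  shows "(omega_defined \<theta> \<phi> \<psi> \<longrightarrow>
            card (C \<inter> strip n \<psi> \<phi>) \<le> max_code_size (n - 1) (min \<omega>\<^sub>1 \<omega>\<^sub>2)) \<and>
         card (C \<inter> strip n \<psi> \<phi> - cap n \<psi>) + 2 * card (C \<inter> cap n \<psi>) \<le> max_code_size n \<omega>\<^sub>1"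
proof -
  obtain m where n: "n = Suc m" using assms(1) by (cases n) auto
  have "\<phi> \<noteq> 0" using assms(6) by (auto simp: omega_defined_def)
  then have \<phi>: "0 < \<phi>" using assms(4) by simp
  have strip_bound: "card (C \<inter> strip n \<psi> \<phi>) \<le> max_code_size (n - 1) (min \<omega>\<^sub>1 \<omega>\<^sub>2)"
    if "omega_defined \<theta> \<phi> \<psi>"
    using strip_code_bound[of m \<theta> C \<phi> \<psi>] assms \<phi> that by (simp add: n)
  have fin: "finite C" using assms(10) by (simp add: spherical_code_def)
  let ?A = "C \<inter> strip n \<psi> \<phi> - cap n \<psi>" and ?B = "C \<inter> cap n \<psi>"
  have "card ?A + card ?B = card (?A \<union> ?B)" using fin by (intro card_Un_disjoint[symmetric]) auto
  also have "\<dots> \<le> card C" using fin by (intro card_mono) auto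
  finally have "card ?A + 2 * card ?B \<le> card C + card ?B" by simp
  also have "\<dots> \<le> max_code_size n \<omega>\<^sub>1"
    using doubled_code_bound[of m \<theta> C \<phi> \<psi>] assms \<phi> by (simp add: n)
  finally show ?thesis using strip_bound by blast
qed

end
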